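(* Let $\Gamma=(V,T,\mathbf{s},\mathbf{r})$ be a network such that there exists $t\in T$ with $o(\mathbf{r}(t))=0$ and such that there does not exist $A\in T^0\setminus V$ with $\mathbf{r}(t)\subseteq A$. Then $Q_\Gamma$ is not $*$-congruence-free as a unary semigroup.
   Context: A network $\Gamma=(V,T,\mathbf{s},\mathbf{r})$ consists of a set $V$ of vertices, a set $T$ of relations, and maps $\mathbf{s},\mathbf{r}:T\to\mathcal{P}(V)$ such that for every $t\in T$ the sets $\mathbf{s}(t)$ and $\mathbf{r}(t)$ are disjoint non-empty subsets of $V$; $V$ and $T$ are finite or countably infinite. A vertex $v$ is identified with the singleton $\{v\}$. Put $T^0=\{A\subseteq V: A=\mathbf{s}(t)\text{ or }A=\mathbf{r}(t)\text{ for some }t\in T\}\cup V$ (so $T^0\setminus V$ consists of the non-singleton sources and ranges), and set $\mathbf{s}(A)=A=\mathbf{r}(A)$ for $A\in T^0$. For $A\subseteq V$, $o(A)$ is the cardinality of $\{t\in T:\mathbf{s}(t)=A\}$. For each $t\in T$ let $t^{-1}$ be a formal symbol with $\mathbf{s}(t^{-1})=\mathbf{r}(t)$, $\mathbf{r}(t^{-1})=\mathbf{s}(t)$; put $A^{-1}=A$ for $A\in T^0$ and $T^{-1}=\{t^{-1}:t\in T\}$. The symbol sets $T$, $T^0$, $T^{-1}$, $\{0\}$ are pairwise disjoint. $Q_\Gamma$ is the semigroup generated by $X=T\cup T^0\cup T^{-1}\cup\{0\}$ subject to the relations: (NR1) $\mathbf{s}(t)t=t=t\mathbf{r}(t)$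 for $t\in T\cup T^0\cup T^{-1}$; (NR2) $t_1t_2=0$ if $\mathbf{r}(t_1)\cap\mathbf{s}(t_2)=\emptyset$, for $t_1,t_2\in T\cup T^0\cup T^{-1}$; (NR3) $t_1^{-1}t_2=0$ if $t_1\neq t_2$, for $t_1,t_2\in T$; (NR4) $t^{-1}t=\mathbf{r}(t)$ for $t\in T$; (NR5) $t^{-1}A=0$ if $\mathbf{s}(t)\neq A$, for $t\in T$, $A\in T^0$; (NR6) $0x=0=x0$ for all $x\in X$. For $a,b$ in a semigroup $S$, $a\,\mathcal{L}^*\,b$ means: for all $x,y\in S^1$, $ax=ay\Leftrightarrow bx=by$. $S$ is right $*$-abundant if each $\mathcal{L}^*$-class contains a unique idempotent; $a^*$ denotes the idempotent in the $\mathcal{L}^*$-class of $a$, and $S$ is regarded as a unary semigroup with the operation $a\mapsto a^*$. $Q_\Gamma$ is right $*$-abundant. A unary semigroup congruence is a semigroup congruence $\rho$ such that $a\,\rho\,b$ implies $a^*\,\rho\,b^*$. A right $*$-abundant semigroup is $*$-congruence-free if its only unary semigroup congruences are the identity and the universal congruence. *)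

theory Defs
  imports
    "HOL-Algebra.Congruence"
    "HOL-Library.Countable_Set"
    "HOL-Library.Extended_Nat"
begin

section \<open>Semigroups and the relation L*\<close>

record 'a sgrp = "'a partial_object" +
  prod :: "'a \<Rightarrow> 'a \<Rightarrow> 'a" (infixl \<open>\<odot>\<index>\<close> 70)

locale sgroup =
  fixes S :: "('a, 'm) sgrp_scheme" (structure)
  assumes closed: "\<lbrakk>a \<in> carrier S; b \<in> carrier S\<rbrakk> \<Longrightarrow> a \<odot> b \<in> carrier S"
    and assoc: "\<lbrakk>a \<in> carrier S; b \<in> carrier S; c \<in> carrier S\<rbrakk>
                  \<Longrightarrow> (a \<odot> b) \<odot> c = a \<odot> (b \<odot> c)"

text \<open>The semigroup \<open>S\<^sup>1\<close>: \<open>None\<close> is an identity, adjoined only if \<open>S\<close> has none.\<close>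

definition with_one :: "('a, 'm) sgrp_scheme \<Rightarrow> 'a option set" where
  "with_one S =
     (if \<exists>e\<in>carrier S. \<forall>x\<in>carrier S. e \<odot>\<^bsub>S\<^esub> x = x \<and> x \<odot>\<^bsub>S\<^esub> e = x
      then Some ` carrier S else insert None (Some ` carrier S))"

fun prod1 :: "('a, 'm) sgrp_scheme \<Rightarrow> 'a \<Rightarrow> 'a option \<Rightarrow> 'a" where
  "prod1 S a None = a"
| "prod1 S a (Some x) = a \<odot>\<^bsub>S\<^esub> x"

definition lstar :: "('a, 'm) sgrp_scheme \<Rightarrow> 'a \<Rightarrow> 'a \<Rightarrow> bool" where
  "lstar S a b \<longleftrightarrow>
     (\<forall>x\<in>with_one S. \<forall>y\<in>with_one S. prod1 S a x = prod1 S a y \<longleftrightarrow> prod1 S b x = prod1 S b y)"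

definition idempotents :: "('a, 'm) sgrp_scheme \<Rightarrow> 'a set" where
  "idempotents S = {e \<in> carrier S. e \<odot>\<^bsub>S\<^esub> e = e}"

definition right_star_abundant :: "('a, 'm) sgrp_scheme \<Rightarrow> bool" where
  "right_star_abundant S \<longleftrightarrow> (\<forall>a\<in>carrier S. \<exists>!e. e \<in> idempotents S \<and> lstar S a e)"

definition star :: "('a, 'm) sgrp_scheme \<Rightarrow> 'a \<Rightarrow> 'a" where
  "star S a = (THE e. e \<in> idempotents S \<and> lstar S a e)"

definition sgrp_congruence :: "('a, 'm) sgrp_scheme \<Rightarrow> ('a \<times> 'a) set \<Rightarrow> bool" where
  "sgrp_congruence S \<rho> \<longleftrightarrow>
     equiv (carrier S) \<rho> \<and>
     (\<forall>a b c d. (a, b) \<in> \<rho> \<longrightarrow> (c, d) \<in> \<rho> \<longrightarrow> (a \<odot>\<^bsub>S\<^esub> c, b \<odot>\<^bsub>S\<^esub> d) \<in> \<rho>)"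

definition unary_congruence ::
  "('a, 'm) sgrp_scheme \<Rightarrow> ('a \<Rightarrow> 'a) \<Rightarrow> ('a \<times> 'a) set \<Rightarrow> bool" where
  "unary_congruence S f \<rho> \<longleftrightarrow>
     sgrp_congruence S \<rho> \<and> (\<forall>a b. (a, b) \<in> \<rho> \<longrightarrow> (f a, f b) \<in> \<rho>)"

text \<open>
  As with \<^const>\<open>star\<close>, this notion is meant for semigroups \<open>S\<close> satisfying
  \<^const>\<open>right_star_abundant\<close>. That property is deliberately not a conjunct of the
  definition: its negation thus always asserts the existence of a unary semigroup congruence
  that is neither the identity nor universal, and never a mere failure of abundance.
\<close>

definition star_congruence_free :: "('a, 'm) sgrp_scheme \<Rightarrow> bool" where
  "star_congruence_free S \<longleftrightarrow>
     (\<forall>\<rho>. unary_congruence S (star S) \<rho> \<longrightarrow>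
        \<rho> = Id_on (carrier S) \<or> \<rho> = carrier S \<times> carrier S)"


section \<open>Semigroup presentations\<close>

text \<open>
  The free semigroup on \<open>X\<close> consists of the nonempty words over \<open>X\<close>. The following is the least
  congruence on it that contains the set \<open>R\<close> of pairs of words.
\<close>

definition nwords :: "'x set \<Rightarrow> 'x list set" where
  "nwords X = lists X - {[]}"

inductive_set pres_cong :: "'x set \<Rightarrow> ('x list \<times> 'x list) set \<Rightarrow> ('x list \<times> 'x list) set"
  for X R where
  base: "\<lbrakk>(u, w) \<in> R; u \<in> nwords X; w \<in> nwords X\<rbrakk> \<Longrightarrow> (u, w) \<in> pres_cong X R"
| refl: "u \<in> nwords X \<Longrightarrow> (u, u) \<in> pres_cong X R"
| sym: "(u, w) \<in> pres_cong X R \<Longrightarrow> (w, u) \<in> pres_cong X R"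
| trans: "\<lbrakk>(u, w) \<in> pres_cong X R; (w, z) \<in> pres_cong X R\<rbrakk> \<Longrightarrow> (u, z) \<in> pres_cong X R"
| append: "\<lbrakk>(u, u') \<in> pres_cong X R; (w, w') \<in> pres_cong X R\<rbrakk>
             \<Longrightarrow> (u @ w, u' @ w') \<in> pres_cong X R"

definition presented_sgrp :: "'x set \<Rightarrow> ('x list \<times> 'x list) set \<Rightarrow> 'x list set sgrp" where
  "presented_sgrp X R =
     \<lparr>carrier = nwords X // pres_cong X R,
      prod = (\<lambda>A B. \<Union>u\<in>A. \<Union>w\<in>B. pres_cong X R `` {u @ w})\<rparr>"

lemma nwords_append: "\<lbrakk>u \<in> nwords X; w \<in> nwords X\<rbrakk> \<Longrightarrow> u @ w \<in> nwords X"
  by (auto simp: nwords_def)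

lemma pres_cong_nwords:
  "(u, w) \<in> pres_cong X R \<Longrightarrow> u \<in> nwords X \<and> w \<in> nwords X"
  by (induction rule: pres_cong.induct) (auto intro: nwords_append)

lemma equiv_pres_cong: "equiv (nwords X) (pres_cong X R)"
proof (rule equivI)
  show "pres_cong X R \<subseteq> nwords X \<times> nwords X"
    using pres_cong_nwords by fast
  show "refl_on (nwords X) (pres_cong X R)"
    by (rule refl_onI) (rule pres_cong.refl)
  show "sym_on UNIV (pres_cong X R)"
    by (rule symI) (rule pres_cong.sym)
  show "trans_on UNIV (pres_cong X R)"
    by (rule transI) (rule pres_cong.trans)
qed

lemma presented_sgrp_prod_class:
  assumes "u \<in> nwords X" "w \<in> nwords X"
  shows "(pres_cong X R `` {u}) \<odot>\<^bsub>presented_sgrp X R\<^esub> (pres_cong X R `` {w})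
           = pres_cong X R `` {u @ w}"
proof -
  have "congruent2 (pres_cong X R) (pres_cong X R) (\<lambda>u w. pres_cong X R `` {u @ w})"
  proof (rule congruent2I')
    fix u u' w w'
    assume "(u, u') \<in> pres_cong X R" "(w, w') \<in> pres_cong X R"
    then have "(u @ w, u' @ w') \<in> pres_cong X R" by (rule pres_cong.append)
    then show "pres_cong X R `` {u @ w} = pres_cong X R `` {u' @ w'}"
      by (rule equiv_class_eq[OF equiv_pres_cong])
  qed
  from UN_equiv_class2[OF equiv_pres_cong equiv_pres_cong this assms]
  show ?thesis by (simp add: presented_sgrp_def)
qed

lemma sgroup_presented_sgrp: "sgroup (presented_sgrp X R)"
proof
  let ?S = "presented_sgrp X R"
  have carrier: "carrier ?S = nwords X // pres_cong X R"
    by (simp add: presented_sgrp_def)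
  show "a \<odot>\<^bsub>?S\<^esub> b \<in> carrier ?S" if "a \<in> carrier ?S" "b \<in> carrier ?S" for a b
    using that unfolding carrier
    by (auto elim!: quotientE simp: presented_sgrp_prod_class intro!: quotientI nwords_append)
  show "(a \<odot>\<^bsub>?S\<^esub> b) \<odot>\<^bsub>?S\<^esub> c = a \<odot>\<^bsub>?S\<^esub> (b \<odot>\<^bsub>?S\<^esub> c)"
    if "a \<in> carrier ?S" "b \<in> carrier ?S" "c \<in> carrier ?S" for a b c
    using that unfolding carrier
    by (auto elim!: quotientE simp: presented_sgrp_prod_class nwords_append)
qed


section \<open>Networks\<close>

record ('v, 't) net =
  verts :: "'v set"
  rels :: "'t set"
  src :: "'t \<Rightarrow> 'v set"
  rng :: "'t \<Rightarrow> 'v set"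

locale network =
  fixes \<Gamma> :: "('v, 't) net"
  assumes countable_verts: "countable (verts \<Gamma>)"
    and countable_rels: "countable (rels \<Gamma>)"
    and src_subset: "t \<in> rels \<Gamma> \<Longrightarrow> src \<Gamma> t \<subseteq> verts \<Gamma>"
    and rng_subset: "t \<in> rels \<Gamma> \<Longrightarrow> rng \<Gamma> t \<subseteq> verts \<Gamma>"
    and src_nonempty: "t \<in> rels \<Gamma> \<Longrightarrow> src \<Gamma> t \<noteq> {}"
    and rng_nonempty: "t \<in> rels \<Gamma> \<Longrightarrow> rng \<Gamma> t \<noteq> {}"
    and src_rng_disjoint: "t \<in> rels \<Gamma> \<Longrightarrow> src \<Gamma> t \<inter> rng \<Gamma> t = {}"

text \<open>The vertices, regarded as subsets of \<open>V\<close> by identifying \<open>v\<close> with \<open>{v}\<close>.\<close>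

definition vsingletons :: "('v, 't) net \<Rightarrow> 'v set set" where
  "vsingletons \<Gamma> = {{v} | v. v \<in> verts \<Gamma>}"

definition T0 :: "('v, 't) net \<Rightarrow> 'v set set" where
  "T0 \<Gamma> = {A. A \<subseteq> verts \<Gamma> \<and> (\<exists>t\<in>rels \<Gamma>. A = src \<Gamma> t \<or> A = rng \<Gamma> t)} \<union> vsingletons \<Gamma>"

text \<open>Not \<^const>\<open>card\<close> itself, which is \<open>0\<close> on infinite sets; all sets here are countable.\<close>

definition outdeg :: "('v, 't) net \<Rightarrow> 'v set \<Rightarrow> enat" where
  "outdeg \<Gamma> A =
     (if finite {t \<in> rels \<Gamma>. src \<Gamma> t = A} then enat (card {t \<in> rels \<Gamma>. src \<Gamma> t = A}) else \<infinity>)"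

datatype ('v, 't) gen = Rel 't | VSet "'v set" | Inv 't | Zero

text \<open>The symbols in \<open>T \<union> T\<^sup>0 \<union> T\<^sup>-\<^sup>1\<close>, without zero.\<close>

definition gens :: "('v, 't) net \<Rightarrow> ('v, 't) gen set" where
  "gens \<Gamma> = Rel ` rels \<Gamma> \<union> VSet ` T0 \<Gamma> \<union> Inv ` rels \<Gamma>"

text \<open>Source and range on \<^const>\<open>gens\<close>; the values at \<^const>\<open>Zero\<close> are never used.\<close>

fun gsrc :: "('v, 't) net \<Rightarrow> ('v, 't) gen \<Rightarrow> 'v set" where
  "gsrc \<Gamma> (Rel t) = src \<Gamma> t"
| "gsrc \<Gamma> (VSet A) = A"
| "gsrc \<Gamma> (Inv t) = rng \<Gamma> t"
| "gsrc \<Gamma> Zero = {}"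

fun grng :: "('v, 't) net \<Rightarrow> ('v, 't) gen \<Rightarrow> 'v set" where
  "grng \<Gamma> (Rel t) = rng \<Gamma> t"
| "grng \<Gamma> (VSet A) = A"
| "grng \<Gamma> (Inv t) = src \<Gamma> t"
| "grng \<Gamma> Zero = {}"

inductive_set network_rels ::
  "('v, 't) net \<Rightarrow> (('v, 't) gen list \<times> ('v, 't) gen list) set"
  for \<Gamma> where
  NR1_left: "g \<in> gens \<Gamma> \<Longrightarrow> ([VSet (gsrc \<Gamma> g), g], [g]) \<in> network_rels \<Gamma>"
| NR1_right: "g \<in> gens \<Gamma> \<Longrightarrow> ([g, VSet (grng \<Gamma> g)], [g]) \<in> network_rels \<Gamma>"
| NR2: "\<lbrakk>g \<in> gens \<Gamma>; h \<in> gens \<Gamma>; grng \<Gamma> g \<inter> gsrc \<Gamma> h = {}\<rbrakk>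
          \<Longrightarrow> ([g, h], [Zero]) \<in> network_rels \<Gamma>"
| NR3: "\<lbrakk>t \<in> rels \<Gamma>; t' \<in> rels \<Gamma>; t \<noteq> t'\<rbrakk> \<Longrightarrow> ([Inv t, Rel t'], [Zero]) \<in> network_rels \<Gamma>"
| NR4: "t \<in> rels \<Gamma> \<Longrightarrow> ([Inv t, Rel t], [VSet (rng \<Gamma> t)]) \<in> network_rels \<Gamma>"
| NR5: "\<lbrakk>t \<in> rels \<Gamma>; A \<in> T0 \<Gamma>; src \<Gamma> t \<noteq> A\<rbrakk>
          \<Longrightarrow> ([Inv t, VSet A], [Zero]) \<in> network_rels \<Gamma>"
| NR6_left: "g \<in> insert Zero (gens \<Gamma>) \<Longrightarrow> ([Zero, g], [Zero]) \<in> network_rels \<Gamma>"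
| NR6_right: "g \<in> insert Zero (gens \<Gamma>) \<Longrightarrow> ([g, Zero], [Zero]) \<in> network_rels \<Gamma>"

definition network_sgrp :: "('v, 't) net \<Rightarrow> ('v, 't) gen list set sgrp" where
  "network_sgrp \<Gamma> = presented_sgrp (insert Zero (gens \<Gamma>)) (network_rels \<Gamma>)"

lemma src_rng_T0:
  assumes "network \<Gamma>" "t \<in> rels \<Gamma>"
  shows "src \<Gamma> t \<in> T0 \<Gamma>" "rng \<Gamma> t \<in> T0 \<Gamma>"
  using assms(2) network.src_subset[OF assms] network.rng_subset[OF assms]
  unfolding T0_def by blast+

lemma gsrc_grng_T0:
  assumes "network \<Gamma>" "g \<in> gens \<Gamma>"
  shows "gsrc \<Gamma> g \<in> T0 \<Gamma>" "grng \<Gamma> g \<in> T0 \<Gamma>"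
  using assms(2) by (auto simp: gens_def src_rng_T0[OF assms(1)])

lemma network_rels_nwords:
  assumes "network \<Gamma>" "(u, w) \<in> network_rels \<Gamma>"
  shows "u \<in> nwords (insert Zero (gens \<Gamma>)) \<and> w \<in> nwords (insert Zero (gens \<Gamma>))"
proof -
  have gens: "t \<in> rels \<Gamma> \<Longrightarrow> Rel t \<in> gens \<Gamma>" "t \<in> rels \<Gamma> \<Longrightarrow> Inv t \<in> gens \<Gamma>"
    "A \<in> T0 \<Gamma> \<Longrightarrow> VSet A \<in> gens \<Gamma>" for t A
    by (auto simp: gens_def)
  show ?thesis
    using assms(2)
    by cases (simp_all add: nwords_def gens src_rng_T0[OF assms(1)] gsrc_grng_T0[OF assms(1)])
qed

end

theory Submission
  imports Defs
begin

text \<open>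
  The hypotheses make \<open>r(t)\<close> a singleton \<open>v\<close> such that no relation starts at a set containing \<open>v\<close>
  and no member of \<open>T\<^sup>0\<close> other than \<open>v\<close> itself contains \<open>v\<close>. Let \<open>I\<close> be the ideal generated by
  \<open>v\<close>. The Rees congruence, which identifies all elements of \<open>I\<close> and nothing else, is a semigroup
  congruence. It is not the identity, since \<open>0\<close> and \<open>v\<close> are distinct elements of \<open>I\<close>, and it is not
  universal, since \<open>s(t)\<close> lies outside \<open>I\<close>. So it remains to see that \<open>a\<^sup>*\<close> is in \<open>I\<close> for each \<open>a\<close>
  in \<open>I\<close>.

  For this the idempotents \<open>a\<^sup>*\<close> have to be known. A nonzero element is a product \<open>u A q\<^sup>-\<^sup>1\<close>,
  where \<open>u\<close> is a product of elements of \<open>T\<close> and \<open>T\<^sup>0\<close> in which neighbours overlap, and \<open>q\<close> is a path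
  that ends at \<open>A\<close>. Its idempotent is \<open>q A q\<^sup>-\<^sup>1\<close>. Indeed \<open>u\<close> can be cancelled on the
  left of \<open>A\<close> (lemma \<open>act_forward_cancel\<close>), and so can \<open>q\<close>, because \<open>q\<^sup>-\<^sup>1 q A = A\<close>; hence both
  \<open>u A q\<^sup>-\<^sup>1\<close> and \<open>q A q\<^sup>-\<^sup>1\<close> are L*-related to \<open>A q\<^sup>-\<^sup>1\<close>. No other idempotent is in the class, because
  \<open>e f = e\<close> forces \<open>f e = e\<close> for \<open>e = q A q\<^sup>-\<^sup>1\<close> and every \<open>f\<close> (lemma \<open>idem_word_absorbs\<close>).

  Finally, let \<open>u A q\<^sup>-\<^sup>1\<close> be a nonzero element of \<open>I\<close>. A letter with \<open>v\<close> in its source or range occurs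
  in it. If it occurs in \<open>q\<^sup>-\<^sup>1\<close>, it also occurs in \<open>q A q\<^sup>-\<^sup>1\<close>. If it occurs in \<open>u\<close>, then its range is
  \<open>v\<close>; the only letter of \<open>T \<union> T\<^sup>0\<close> that may follow is \<open>v\<close> again, and so \<open>A\<close> is \<open>v\<close>
  (lemma \<open>sink_reaches_end\<close>). In both cases \<open>q A q\<^sup>-\<^sup>1\<close> is in \<open>I\<close>.

  All inequalities above, and both cancellation arguments, rest on normal forms. The defining
  relations, read as length-reducing rewrite rules, become confluent once the consequence
  \<open>t\<^sup>-\<^sup>1 s\<^sup>-\<^sup>1 = 0\<close> for \<open>s(t) \<noteq> r(s)\<close> is added. Instead of confluence the proof uses the left action
  of words on irreducible words: the relations hold for the action, and letting a word act on the
  empty word yields its normal form. Equality in \<open>Q\<close> is therefore equality of normal forms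
  (lemma \<open>eqv_iff_nf\<close>).
\<close>

section \<open>Presentations, Rees congruences and the star operation\<close>

lemma pres_cong_append_left:
  assumes "(u, w) \<in> pres_cong X R" "z \<in> lists X"
  shows "(z @ u, z @ w) \<in> pres_cong X R"
proof (cases "z = []")
  case False
  then have "(z, z) \<in> pres_cong X R" using assms(2) by (intro pres_cong.refl) (auto simp: nwords_def)
  then show ?thesis using assms(1) by (rule pres_cong.append)
qed (use assms in simp)

lemma pres_cong_append_right:
  assumes "(u, w) \<in> pres_cong X R" "z \<in> lists X"
  shows "(u @ z, w @ z) \<in> pres_cong X R"
proof (cases "z = []")
  case False
  then have "(z, z) \<in> pres_cong X R" using assms(2) by (intro pres_cong.refl) (auto simp: nwords_def)
  then show ?thesis using assms(1) by (intro pres_cong.append)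
qed (use assms in simp)

text \<open>
  The congruence is equality outside \<open>I\<close>, so all that compatibility with \<open>f\<close> demands there is that
  \<open>f\<close> has its values in the carrier.
\<close>

lemma rees_unary_congruence:
  assumes S: "sgroup S" and I: "I \<subseteq> carrier S"
    and ideal: "\<And>a b. a \<in> I \<Longrightarrow> b \<in> carrier S \<Longrightarrow> a \<odot>\<^bsub>S\<^esub> b \<in> I \<and> b \<odot>\<^bsub>S\<^esub> a \<in> I"
    and f: "\<And>a. a \<in> carrier S \<Longrightarrow> f a \<in> carrier S" "\<And>a. a \<in> I \<Longrightarrow> f a \<in> I"
  shows "unary_congruence S f (Id_on (carrier S) \<union> I \<times> I)"
proof -
  let ?\<rho> = "Id_on (carrier S) \<union> I \<times> I"
  have "refl_on (carrier S) ?\<rho>" by (rule refl_onI) auto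
  moreover have "?\<rho> \<subseteq> carrier S \<times> carrier S" using I by auto
  moreover have "sym ?\<rho>" by (rule symI) auto
  moreover have "trans ?\<rho>" by (rule transI) auto
  ultimately have "equiv (carrier S) ?\<rho>" by (intro equivI)
  moreover have "(a \<odot>\<^bsub>S\<^esub> c, b \<odot>\<^bsub>S\<^esub> d) \<in> ?\<rho>" if ab: "(a, b) \<in> ?\<rho>" and cd: "(c, d) \<in> ?\<rho>" for a b c d
  proof -
    have car: "a \<in> carrier S" "b \<in> carrier S" "c \<in> carrier S" "d \<in> carrier S"
      using ab cd I by auto
    consider "a = b" "c = d" | "a \<in> I" "b \<in> I" | "c \<in> I" "d \<in> I" using ab cd by auto
    then show ?thesis
    proof cases
      case 1
      then show ?thesis using sgroup.closed[OF S car(1,3)] by auto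
    qed (use ideal car in auto)
  qed
  moreover have "(f a, f b) \<in> ?\<rho>" if "(a, b) \<in> ?\<rho>" for a b using that f by auto
  ultimately show ?thesis unfolding unary_congruence_def sgrp_congruence_def by blast
qed

lemma not_star_congruence_free_if_ideal:
  assumes "sgroup S" "I \<subseteq> carrier S"
    and "\<And>a b. a \<in> I \<Longrightarrow> b \<in> carrier S \<Longrightarrow> a \<odot>\<^bsub>S\<^esub> b \<in> I \<and> b \<odot>\<^bsub>S\<^esub> a \<in> I"
    and "\<And>a. a \<in> carrier S \<Longrightarrow> star S a \<in> carrier S" "\<And>a. a \<in> I \<Longrightarrow> star S a \<in> I"
    and "x \<in> I" "y \<in> I" "x \<noteq> y" "z \<in> carrier S" "z \<notin> I"
  shows "\<not> star_congruence_free S"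
proof -
  let ?\<rho> = "Id_on (carrier S) \<union> I \<times> I"
  have "unary_congruence S (star S) ?\<rho>" using assms(1-5) by (rule rees_unary_congruence)
  moreover have "(x, y) \<in> ?\<rho>" "(x, y) \<notin> Id_on (carrier S)" using assms(6-8) by auto
  moreover have "(x, z) \<notin> ?\<rho>" "(x, z) \<in> carrier S \<times> carrier S" using assms(2,6,9,10) by auto
  ultimately show ?thesis unfolding star_congruence_free_def by metis
qed

lemma lstar_sym: "lstar S a b \<Longrightarrow> lstar S b a"
  by (simp add: lstar_def)

lemma lstar_trans: "lstar S a b \<Longrightarrow> lstar S b c \<Longrightarrow> lstar S a c"
  by (simp add: lstar_def)

text \<open>
  L*-relatedness transfers the equation \<open>e e = e 1\<close>. The two cases are needed because \<open>S\<^sup>1\<close> contains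
  an extra identity only if the semigroup has none of its own.
\<close>

lemma lstar_idempotent_absorb:
  assumes e: "e \<in> idempotents S" and f: "f \<in> carrier S" and L: "lstar S e f"
  shows "f \<odot>\<^bsub>S\<^esub> e = f"
proof (cases "\<exists>i\<in>carrier S. \<forall>x\<in>carrier S. i \<odot>\<^bsub>S\<^esub> x = x \<and> x \<odot>\<^bsub>S\<^esub> i = x")
  case True
  then obtain i where i: "i \<in> carrier S" "\<And>x. x \<in> carrier S \<Longrightarrow> x \<odot>\<^bsub>S\<^esub> i = x" by blast
  have "Some e \<in> with_one S" "Some i \<in> with_one S"
    using True e i by (auto simp: with_one_def idempotents_def)
  then have "prod1 S e (Some e) = prod1 S e (Some i) \<longleftrightarrow> prod1 S f (Some e) = prod1 S f (Some i)"
    using L unfolding lstar_def by blast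
  then show ?thesis using e f i by (simp add: idempotents_def)
next
  case False
  have "Some e \<in> with_one S" "None \<in> with_one S"
    using False e by (auto simp: with_one_def idempotents_def)
  then have "prod1 S e (Some e) = prod1 S e None \<longleftrightarrow> prod1 S f (Some e) = prod1 S f None"
    using L unfolding lstar_def by blast
  then show ?thesis using e by (simp add: idempotents_def)
qed

text \<open>
  L*-related idempotents satisfy \<open>e f = e\<close> and \<open>f e = f\<close>, and this alone does not make them equal.
  The assumption on \<open>e\<close> closes the gap: it turns the first equation into \<open>f e = e\<close>.
\<close>

lemma star_eqI:
  assumes e: "e \<in> idempotents S" and L: "lstar S a e"
    and absorb: "\<And>f. f \<in> idempotents S \<Longrightarrow> e \<odot>\<^bsub>S\<^esub> f = e \<Longrightarrow> f \<odot>\<^bsub>S\<^esub> e = e"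
  shows "star S a = e"
  unfolding star_def
proof (rule the_equality)
  show "f = e" if f: "f \<in> idempotents S \<and> lstar S a f" for f
  proof -
    have fe: "lstar S f e" using f L by (blast intro: lstar_sym lstar_trans)
    have "e \<in> carrier S" "f \<in> carrier S" using e f by (auto simp: idempotents_def)
    then have "e \<odot>\<^bsub>S\<^esub> f = e" "f \<odot>\<^bsub>S\<^esub> e = f"
      using e f fe lstar_sym[OF fe] by (auto intro: lstar_idempotent_absorb)
    with absorb f show ?thesis by metis
  qed
qed (use e L in simp)

section \<open>Irreducible words and the left action on them\<close>

text \<open>
  The pairs of letters to which no rewrite rule applies. The final conjunct records that nothing but
  another inverse can follow an inverse \<open>t\<^sup>-\<^sup>1\<close>: its products with elements of \<open>T\<close> and \<open>T\<^sup>0\<close> all reduce,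
  and so does \<open>t\<^sup>-\<^sup>1 s\<^sup>-\<^sup>1 = t\<^sup>-\<^sup>1 r(s) s\<^sup>-\<^sup>1 = 0\<close> when \<open>s(t) \<noteq> r(s)\<close>.
\<close>

definition irreducible_pair :: "('v, 't) net \<Rightarrow> ('v, 't) gen \<Rightarrow> ('v, 't) gen \<Rightarrow> bool" where
  "irreducible_pair \<Gamma> g h \<longleftrightarrow> grng \<Gamma> g \<inter> gsrc \<Gamma> h \<noteq> {} \<and> g \<noteq> VSet (gsrc \<Gamma> h) \<and> h \<noteq> VSet (grng \<Gamma> g) \<and>
     (\<forall>t. g = Inv t \<longrightarrow> (\<exists>s. h = Inv s \<and> src \<Gamma> t = rng \<Gamma> s))"

text \<open>
  The empty word is included as the point on which words act, although it represents no element of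
  the semigroup.
\<close>

definition normal :: "('v, 't) net \<Rightarrow> ('v, 't) gen list \<Rightarrow> bool" where
  "normal \<Gamma> z \<longleftrightarrow> z = [Zero] \<or> z \<in> lists (gens \<Gamma>) \<and> successively (irreducible_pair \<Gamma>) z"

fun is_inv :: "('v, 't) gen \<Rightarrow> bool" where
  "is_inv (Inv t) = True"
| "is_inv _ = False"

text \<open>
  The normal form of \<open>g z\<close> for irreducible \<open>z\<close>. The third case deletes a letter \<open>h = r(g)\<close>. What
  then meets \<open>g\<close> is the next letter \<open>k\<close>, whose source overlaps \<open>h\<close> without being equal to it. This
  is irreducible when \<open>g\<close> is in \<open>T\<close>, but \<open>t\<^sup>-\<^sup>1 k = 0\<close> since \<open>s(t)\<close> is not the source of \<open>k\<close>. The
  recursion has depth one, as it only multiplies by an element of \<open>T\<^sup>0\<close>.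
\<close>

fun lmul :: "('v, 't) net \<Rightarrow> ('v, 't) gen \<Rightarrow> ('v, 't) gen list \<Rightarrow> ('v, 't) gen list" where
  "lmul \<Gamma> g [] = [g]"
| "lmul \<Gamma> g (h # z) =
     (if grng \<Gamma> g \<inter> gsrc \<Gamma> h = {} then [Zero]
      else if g = VSet (gsrc \<Gamma> h) then h # z
      else if h = VSet (grng \<Gamma> g) then (if is_inv g \<and> z \<noteq> [] then [Zero] else g # z)
      else if irreducible_pair \<Gamma> g h then g # h # z
      else (case (g, h) of
              (Inv t, Rel s) \<Rightarrow> if t = s then lmul \<Gamma> (VSet (rng \<Gamma> t)) z else [Zero]
            | _ \<Rightarrow> [Zero]))"

abbreviation act :: "('v, 't) net \<Rightarrow> ('v, 't) gen list \<Rightarrow> ('v, 't) gen list \<Rightarrow> ('v, 't) gen list" where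
  "act \<Gamma> u z \<equiv> foldr (lmul \<Gamma>) u z"

abbreviation nf :: "('v, 't) net \<Rightarrow> ('v, 't) gen list \<Rightarrow> ('v, 't) gen list" where
  "nf \<Gamma> u \<equiv> act \<Gamma> u []"

abbreviation syms :: "('v, 't) net \<Rightarrow> ('v, 't) gen set" where
  "syms \<Gamma> \<equiv> insert Zero (gens \<Gamma>)"

lemma lmul_Zero [simp]: "lmul \<Gamma> Zero z = [Zero]" "lmul \<Gamma> g [Zero] = [Zero]"
  by (cases z; simp)+

lemma lmul_VSet:
  "lmul \<Gamma> (VSet A) (h # z) =
     (if A \<inter> gsrc \<Gamma> h = {} then [Zero] else if A = gsrc \<Gamma> h then h # z else VSet A # h # z)"
  by (auto simp: irreducible_pair_def)

lemma lmul_nonempty: "lmul \<Gamma> g z \<noteq> []"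
proof (cases z)
  case (Cons h w)
  have "lmul \<Gamma> (VSet A) w \<noteq> []" for A by (cases w) (auto simp: lmul_VSet simp del: lmul.simps(2))
  then show ?thesis using Cons by (auto split: gen.splits)
qed simp

lemma act_nonempty: "z \<noteq> [] \<Longrightarrow> act \<Gamma> u z \<noteq> []"
  by (cases u) (auto simp: lmul_nonempty)

context network
begin

lemma T0_nonempty: "A \<in> T0 \<Gamma> \<Longrightarrow> A \<noteq> {}"
  using src_nonempty rng_nonempty by (auto simp: T0_def vsingletons_def)

lemma gens_simps [simp]:
  "Rel t \<in> gens \<Gamma> \<longleftrightarrow> t \<in> rels \<Gamma>" "Inv t \<in> gens \<Gamma> \<longleftrightarrow> t \<in> rels \<Gamma>"
  "VSet A \<in> gens \<Gamma> \<longleftrightarrow> A \<in> T0 \<Gamma>" "Zero \<notin> gens \<Gamma>"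
  by (auto simp: gens_def)

lemma src_rng_in [simp]: "t \<in> rels \<Gamma> \<Longrightarrow> src \<Gamma> t \<in> T0 \<Gamma>" "t \<in> rels \<Gamma> \<Longrightarrow> rng \<Gamma> t \<in> T0 \<Gamma>"
  using src_rng_T0[OF network_axioms] by auto

lemma gsrc_grng_in [simp]:
  "g \<in> gens \<Gamma> \<Longrightarrow> gsrc \<Gamma> g \<in> T0 \<Gamma>" "g \<in> gens \<Gamma> \<Longrightarrow> grng \<Gamma> g \<in> T0 \<Gamma>"
  using gsrc_grng_T0[OF network_axioms] by auto

lemma normal_Nil [simp]: "normal \<Gamma> []" by (simp add: normal_def)

lemma normal_Zero [simp]: "normal \<Gamma> [Zero]" by (simp add: normal_def)

lemma normal_Cons:
  "normal \<Gamma> (g # z) \<longleftrightarrow>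
     (g = Zero \<and> z = [] \<or>
      g \<in> gens \<Gamma> \<and> z \<noteq> [Zero] \<and> normal \<Gamma> z \<and> (z = [] \<or> irreducible_pair \<Gamma> g (hd z)))"
  by (cases z) (auto simp: normal_def)

lemma normal_lmul_VSet:
  assumes "A \<in> T0 \<Gamma>" "normal \<Gamma> z" shows "normal \<Gamma> (lmul \<Gamma> (VSet A) z)"
  using assms
  by (cases z) (auto simp: lmul_VSet normal_Cons irreducible_pair_def simp del: lmul.simps(2))

lemma normal_lmul:
  assumes g: "g \<in> syms \<Gamma>" and z: "normal \<Gamma> z" shows "normal \<Gamma> (lmul \<Gamma> g z)"
proof (cases z)
  case Nil
  then show ?thesis using g by (auto simp: normal_Cons)
next
  case (Cons h w)
  have "normal \<Gamma> w" using z Cons by (auto simp: normal_Cons)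
  then have "t \<in> rels \<Gamma> \<Longrightarrow> normal \<Gamma> (lmul \<Gamma> (VSet (rng \<Gamma> t)) w)" for t
    by (simp add: normal_lmul_VSet)
  then show ?thesis using g z Cons
    by (cases g) (auto simp: normal_Cons irreducible_pair_def split: gen.splits)
qed

lemma normal_act: "u \<in> lists (syms \<Gamma>) \<Longrightarrow> normal \<Gamma> z \<Longrightarrow> normal \<Gamma> (act \<Gamma> u z)"
  by (induction u) (auto intro: normal_lmul)

lemma normal_lists: "normal \<Gamma> z \<Longrightarrow> z \<in> lists (syms \<Gamma>)"
  by (auto simp: normal_def)

text \<open>
  Together with the invariance of the action under the defining relations, this makes distinct
  irreducible words represent distinct elements.
\<close>

lemma nf_normal: "normal \<Gamma> z \<Longrightarrow> nf \<Gamma> z = z"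
proof (induction z)
  case (Cons g z)
  then show ?case
    by (cases z) (auto simp: normal_Cons irreducible_pair_def)
qed simp

text \<open>
  A nonzero product keeps the source of its first factor. The first half of (NR1)
  and the relations (NR2) and (NR5) hold for the action for this reason.
\<close>

lemma lmul_cases:
  assumes "g \<in> gens \<Gamma>"
  obtains "lmul \<Gamma> g z = [Zero]" | h w where "lmul \<Gamma> g z = h # w" "gsrc \<Gamma> h = gsrc \<Gamma> g"
proof -
  have V: "lmul \<Gamma> (VSet A) w = [Zero] \<or> (\<exists>h w'. lmul \<Gamma> (VSet A) w = h # w' \<and> gsrc \<Gamma> h = A)" for A w
    by (cases w) (auto simp: lmul_VSet simp del: lmul.simps(2))
  have "lmul \<Gamma> g z = [Zero] \<or> (\<exists>h w. lmul \<Gamma> g z = h # w \<and> gsrc \<Gamma> h = gsrc \<Gamma> g)"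
    by (cases z) (use V in \<open>auto split: gen.splits\<close>)
  then show thesis using that by blast
qed

lemma lmul_NR1_left:
  assumes "g \<in> gens \<Gamma>" shows "lmul \<Gamma> (VSet (gsrc \<Gamma> g)) (lmul \<Gamma> g z) = lmul \<Gamma> g z"
  by (rule lmul_cases[OF assms, of z])
    (use T0_nonempty gsrc_grng_in(1)[OF assms] in \<open>auto simp: lmul_VSet simp del: lmul.simps(2)\<close>)

lemma lmul_NR1_right:
  assumes "g \<in> gens \<Gamma>" shows "lmul \<Gamma> g (lmul \<Gamma> (VSet (grng \<Gamma> g)) z) = lmul \<Gamma> g z"
proof (cases z)
  case Nil
  then show ?thesis using T0_nonempty[OF gsrc_grng_in(2)[OF assms]] by (cases g) auto
next
  case (Cons h w)
  then show ?thesis using T0_nonempty[OF gsrc_grng_in(2)[OF assms]]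
    by (cases g; cases h) (auto simp: irreducible_pair_def)
qed

lemma lmul_NR2:
  assumes "h \<in> gens \<Gamma>" "grng \<Gamma> g \<inter> gsrc \<Gamma> h = {}" shows "lmul \<Gamma> g (lmul \<Gamma> h z) = [Zero]"
  by (rule lmul_cases[OF assms(1), of z]) (use assms in auto)

lemma lmul_Rel_cases: "lmul \<Gamma> (Rel t) z = [Zero] \<or> (\<exists>w. lmul \<Gamma> (Rel t) z = Rel t # w)"
  by (cases z) auto

lemma lmul_NR3:
  assumes "t \<noteq> t'" shows "lmul \<Gamma> (Inv t) (lmul \<Gamma> (Rel t') z) = [Zero]"
  using lmul_Rel_cases[of t' z] assms by (auto simp: irreducible_pair_def)

text \<open>
  Irreducibility of \<open>z\<close> matters when \<open>z\<close> begins with \<open>r(t)\<close>. Multiplication by \<open>t\<close> absorbs this letter,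
  and \<open>t\<^sup>-\<^sup>1 t\<close> has to restore it; so the second letter must not absorb it.
\<close>

lemma lmul_NR4:
  assumes "t \<in> rels \<Gamma>" "normal \<Gamma> z"
  shows "lmul \<Gamma> (Inv t) (lmul \<Gamma> (Rel t) z) = lmul \<Gamma> (VSet (rng \<Gamma> t)) z"
proof (cases z)
  case Nil
  then show ?thesis using src_nonempty[OF assms(1)] by (auto simp: irreducible_pair_def)
next
  case (Cons h w)
  then show ?thesis using src_nonempty[OF assms(1)] assms(2)
    by (cases w) (auto simp: irreducible_pair_def normal_Cons)
qed

lemma lmul_NR5:
  assumes "A \<in> T0 \<Gamma>" "src \<Gamma> t \<noteq> A" shows "lmul \<Gamma> (Inv t) (lmul \<Gamma> (VSet A) z) = [Zero]"
proof -
  have "VSet A \<in> gens \<Gamma>" using assms by simp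
  from lmul_cases[OF this, of z] show ?thesis
  proof cases
    case (2 h w)
    then show ?thesis using assms by (cases h) (auto simp: irreducible_pair_def)
  qed auto
qed

lemma network_rels_act:
  assumes "(u, w) \<in> network_rels \<Gamma>" "normal \<Gamma> z" shows "act \<Gamma> u z = act \<Gamma> w z"
  using assms
  by cases (auto simp: lmul_NR1_left lmul_NR1_right lmul_NR2 lmul_NR3 lmul_NR4 lmul_NR5
      simp del: lmul.simps(2))

section \<open>The word problem\<close>

abbreviation eqv :: "('v, 't) gen list \<Rightarrow> ('v, 't) gen list \<Rightarrow> bool" (infix \<open>\<approx>\<close> 50) where
  "u \<approx> w \<equiv> (u, w) \<in> pres_cong (syms \<Gamma>) (network_rels \<Gamma>)"

lemma pres_cong_act: "u \<approx> w \<Longrightarrow> normal \<Gamma> z \<Longrightarrow> act \<Gamma> u z = act \<Gamma> w z"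
proof (induction arbitrary: z rule: pres_cong.induct)
  case (append u u' w w')
  then have "normal \<Gamma> (act \<Gamma> w' z)"
    using pres_cong_nwords[OF append.hyps(2)] by (intro normal_act) (auto simp: nwords_def)
  with append show ?case by simp
qed (auto simp: network_rels_act)

lemma eqv_rel: "(u, w) \<in> network_rels \<Gamma> \<Longrightarrow> u \<approx> w"
  using network_rels_nwords[OF network_axioms] by (blast intro: pres_cong.base)

lemma eqv_rel_context:
  "(u, w) \<in> network_rels \<Gamma> \<Longrightarrow> z \<in> lists (syms \<Gamma>) \<Longrightarrow> u @ z \<approx> w @ z"
  by (rule pres_cong_append_right[OF eqv_rel])

lemma eqv_Zero: "z \<in> lists (syms \<Gamma>) \<Longrightarrow> Zero # z \<approx> [Zero]"
proof (induction z)
  case Nil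
  show ?case by (rule pres_cong.refl) (simp add: nwords_def)
next
  case (Cons g z)
  then have "Zero # g # z \<approx> Zero # z"
    using eqv_rel_context[OF NR6_left, of g z] by simp
  with Cons show ?case by (auto intro: pres_cong.trans)
qed

lemma eqv_rel_Zero:
  assumes "(u, [Zero]) \<in> network_rels \<Gamma>" "z \<in> lists (syms \<Gamma>)" shows "u @ z \<approx> [Zero]"
  using eqv_rel_context[OF assms] eqv_Zero[OF assms(2)] by (auto intro: pres_cong.trans)

text \<open>
  Inserting the source of \<open>k\<close> between \<open>t\<^sup>-\<^sup>1\<close> and \<open>k\<close> makes (NR5) applicable. For \<open>k\<close> in \<open>T\<^sup>-\<^sup>1\<close> this is
  the rule that completes the rewriting system.
\<close>

lemma eqv_Inv_Zero:
  assumes "t \<in> rels \<Gamma>" "k \<in> gens \<Gamma>" "gsrc \<Gamma> k \<noteq> src \<Gamma> t" "z \<in> lists (syms \<Gamma>)"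
  shows "Inv t # k # z \<approx> [Zero]"
proof -
  have "[VSet (gsrc \<Gamma> k), k] @ z \<approx> [k] @ z"
    using assms by (intro eqv_rel_context NR1_left) auto
  from pres_cong_append_left[OF this, of "[Inv t]"] assms
  have "Inv t # VSet (gsrc \<Gamma> k) # k # z \<approx> Inv t # k # z" by simp
  moreover have "[Inv t, VSet (gsrc \<Gamma> k)] @ (k # z) \<approx> [Zero]"
    using assms by (intro eqv_rel_Zero NR5) auto
  ultimately show ?thesis by (auto intro: pres_cong.trans pres_cong.sym)
qed

lemma eqv_refl: "z \<in> lists (syms \<Gamma>) \<Longrightarrow> g \<in> syms \<Gamma> \<Longrightarrow> g # z \<approx> g # z"
  by (rule pres_cong.refl) (auto simp: nwords_def)

text \<open>
  Every clause of the action is a consequence of the defining relations. This is the converse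
  of the invariance of the action under those relations.
\<close>

lemma eqv_lmul:
  assumes "g \<in> syms \<Gamma>" "normal \<Gamma> z" shows "g # z \<approx> lmul \<Gamma> g z"
  using assms
proof (induction z arbitrary: g)
  case Nil
  then show ?case by (auto intro: eqv_refl)
next
  case (Cons h z)
  have z: "normal \<Gamma> z" "z \<in> lists (syms \<Gamma>)" and h: "h \<in> syms \<Gamma>"
    using Cons.prems normal_lists by (auto simp: normal_Cons)
  consider "g = Zero \<or> h = Zero" | (gens) "g \<in> gens \<Gamma>" "h \<in> gens \<Gamma>"
    using Cons.prems h by auto
  then show ?case
  proof cases
    case 1
    have "([g, h], [Zero]) \<in> network_rels \<Gamma>"
      using 1 NR6_left[of h] NR6_right[of g] Cons.prems h by auto
    from eqv_rel_Zero[OF this z(2)] 1 show ?thesis by auto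
  next
    case gens
    consider (dis) "grng \<Gamma> g \<inter> gsrc \<Gamma> h = {}"
      | (left) "grng \<Gamma> g \<inter> gsrc \<Gamma> h \<noteq> {}" "g = VSet (gsrc \<Gamma> h)"
      | (right) "grng \<Gamma> g \<inter> gsrc \<Gamma> h \<noteq> {}" "g \<noteq> VSet (gsrc \<Gamma> h)" "h = VSet (grng \<Gamma> g)"
      | (irr) "irreducible_pair \<Gamma> g h"
      | (inv) t where "g = Inv t" "h = Rel t" "grng \<Gamma> g \<inter> gsrc \<Gamma> h \<noteq> {}"
      | (inv') t s where "g = Inv t" "h = Rel s" "t \<noteq> s" "grng \<Gamma> g \<inter> gsrc \<Gamma> h \<noteq> {}"
      | (Inv) t where "g = Inv t" "gsrc \<Gamma> h \<noteq> src \<Gamma> t" "\<forall>s. h \<noteq> Rel s"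
          "grng \<Gamma> g \<inter> gsrc \<Gamma> h \<noteq> {}" "h \<noteq> VSet (grng \<Gamma> g)" "\<not> irreducible_pair \<Gamma> g h"
      by (cases g; cases h) (auto simp: irreducible_pair_def)
    then show ?thesis
    proof cases
      case dis
      then show ?thesis using eqv_rel_Zero[OF NR2 z(2), of g h] gens by auto
    next
      case left
      then show ?thesis using eqv_rel_context[OF NR1_left z(2), of h] gens by auto
    next
      case right
      have red: "g # h # z \<approx> g # z"
        using right eqv_rel_context[OF NR1_right z(2), of g] gens by auto
      show ?thesis
      proof (cases "is_inv g \<and> z \<noteq> []")
        case True
        then obtain t k y where *: "g = Inv t" "z = k # y" by (cases g; cases z) auto
        have "Inv t # k # y \<approx> [Zero]"
          using Cons.prems gens * right z(2)
          by (intro eqv_Inv_Zero) (auto simp: normal_Cons irreducible_pair_def)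
        with red * right show ?thesis by (auto intro: pres_cong.trans)
      next
        case False
        with red right show ?thesis by auto
      qed
    next
      case irr
      then have "lmul \<Gamma> g (h # z) = g # h # z" by (auto simp: irreducible_pair_def)
      then show ?thesis using eqv_refl[of "h # z" g] z h Cons.prems by simp
    next
      case inv
      have "g # h # z \<approx> VSet (rng \<Gamma> t) # z"
        using inv eqv_rel_context[OF NR4 z(2), of t] gens by auto
      moreover have "VSet (rng \<Gamma> t) # z \<approx> lmul \<Gamma> (VSet (rng \<Gamma> t)) z"
        using inv gens z by (intro Cons.IH) auto
      ultimately show ?thesis using inv by (auto simp: irreducible_pair_def intro: pres_cong.trans)
    next
      case inv'
      then show ?thesis using eqv_rel_Zero[OF NR3 z(2), of t s] gens by (auto simp: irreducible_pair_def)
    next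
      case Inv
      then have "lmul \<Gamma> g (h # z) = [Zero]" by (cases h) auto
      then show ?thesis using Inv eqv_Inv_Zero[of t h z] gens z by auto
    qed
  qed
qed

lemma eqv_nf:
  assumes "u \<in> lists (syms \<Gamma>)" "u \<noteq> []" shows "u \<approx> nf \<Gamma> u"
  using assms
proof (induction u rule: list.induct)
  case (Cons g u)
  have "u \<in> lists (syms \<Gamma>)" using Cons.prems by simp
  then have n: "normal \<Gamma> (nf \<Gamma> u)" by (intro normal_act) simp_all
  have "g # u \<approx> g # nf \<Gamma> u"
  proof (cases "u = []")
    case True
    then show ?thesis using Cons.prems by (auto intro: eqv_refl)
  next
    case False
    then show ?thesis using Cons pres_cong_append_left[of u "nf \<Gamma> u" _ _ "[g]"] by auto
  qed
  also have "g # nf \<Gamma> u \<approx> lmul \<Gamma> g (nf \<Gamma> u)" using Cons.prems n by (intro eqv_lmul) auto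
  finally (pres_cong.trans) show ?case by simp
qed simp

text \<open>
  Invariance of the action separates words with different normal forms, and derivability of the normal
  form identifies words with the same one.
\<close>

lemma eqv_iff_nf:
  assumes "u \<in> nwords (syms \<Gamma>)" "w \<in> nwords (syms \<Gamma>)"
  shows "u \<approx> w \<longleftrightarrow> nf \<Gamma> u = nf \<Gamma> w"
proof
  assume "nf \<Gamma> u = nf \<Gamma> w"
  moreover have "u \<approx> nf \<Gamma> u" "w \<approx> nf \<Gamma> w" using assms by (auto simp: nwords_def intro: eqv_nf)
  ultimately show "u \<approx> w" by (metis pres_cong.sym pres_cong.trans)
qed (simp add: pres_cong_act)

lemma act_eq_if_nf_eq:
  assumes "u \<in> lists (syms \<Gamma>)" "w \<in> lists (syms \<Gamma>)" "u \<noteq> []" "w \<noteq> []"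
    and "nf \<Gamma> u = nf \<Gamma> w" "normal \<Gamma> z"
  shows "act \<Gamma> u z = act \<Gamma> w z"
  using assms eqv_iff_nf[of u w] by (auto simp: nwords_def intro: pres_cong_act)


section \<open>Factorisation and left cancellation\<close>

text \<open>
  The path is listed backwards, from its end at the given set: the list \<open>q\<^sub>1, \<dots>, q\<^sub>n\<close> stands for the
  path \<open>q\<^sub>n \<dots> q\<^sub>1\<close> and its inverse is read off in the order \<open>q\<^sub>1\<^sup>-\<^sup>1 \<dots> q\<^sub>n\<^sup>-\<^sup>1\<close>.
\<close>

primrec path_into :: "'v set \<Rightarrow> 't list \<Rightarrow> bool" where
  "path_into A [] = True"
| "path_into A (t # q) = (t \<in> rels \<Gamma> \<and> rng \<Gamma> t = A \<and> path_into (src \<Gamma> t) q)"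

text \<open>
  The idempotent \<open>q A q\<^sup>-\<^sup>1\<close>. A nonempty path that ends at \<open>A\<close> absorbs the middle factor; for the empty
  path the middle factor gives the idempotent \<open>A\<close> itself.
\<close>

definition idem_word :: "'v set \<Rightarrow> 't list \<Rightarrow> ('v, 't) gen list" where
  "idem_word A q = map Rel (rev q) @ VSet A # map Inv q"

definition overlapping :: "('v, 't) gen list \<Rightarrow> bool" where
  "overlapping = successively (\<lambda>g h. grng \<Gamma> g \<inter> gsrc \<Gamma> h \<noteq> {})"

definition forward :: "('v, 't) gen list \<Rightarrow> bool" where
  "forward u \<longleftrightarrow> u \<in> lists (gens \<Gamma>) \<and> (\<forall>g\<in>set u. \<not> is_inv g)"

lemma path_into_rels: "path_into A q \<Longrightarrow> set q \<subseteq> rels \<Gamma>"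
  by (induction q arbitrary: A) auto

lemma path_into_lists:
  assumes "path_into A q"
  shows "map Rel (rev q) \<in> lists (syms \<Gamma>)" "map Inv q \<in> lists (syms \<Gamma>)"
  using path_into_rels[OF assms] by (auto simp: subset_iff)

lemma idem_word_lists:
  "path_into A q \<Longrightarrow> A \<in> T0 \<Gamma> \<Longrightarrow> idem_word A q \<in> lists (syms \<Gamma>)"
  using path_into_lists unfolding idem_word_def by fastforce

text \<open>
  \<open>q\<^sup>-\<^sup>1 q A = A\<close>. The path collapses from its start, by (NR4) for its first relation; the ranges
  produced in this way are absorbed because consecutive relations of a path match exactly.
\<close>

lemma act_inverse_path:
  assumes "path_into A q" "A \<in> T0 \<Gamma>" "normal \<Gamma> z"
  shows "act \<Gamma> (map Inv q) (act \<Gamma> (map Rel (rev q)) (lmul \<Gamma> (VSet A) z)) = lmul \<Gamma> (VSet A) z"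
  using assms
proof (induction q arbitrary: A z)
  case (Cons t q)
  let ?z = "lmul \<Gamma> (Rel t) (lmul \<Gamma> (VSet A) z)"
  have t: "t \<in> rels \<Gamma>" "A = rng \<Gamma> t" "path_into (src \<Gamma> t) q" using Cons.prems by auto
  have n: "normal \<Gamma> (lmul \<Gamma> (VSet A) z)" using Cons.prems by (intro normal_lmul) auto
  have "lmul \<Gamma> (VSet (src \<Gamma> t)) ?z = ?z" using lmul_NR1_left[of "Rel t"] t by simp
  moreover have "normal \<Gamma> ?z" using n t by (intro normal_lmul[OF _ n]) simp
  ultimately have "act \<Gamma> (map Inv q) (act \<Gamma> (map Rel (rev q)) ?z) = ?z"
    using Cons.IH[of "src \<Gamma> t" ?z] t by simp
  then show ?case
    using lmul_NR4[OF t(1) n] lmul_NR1_left[of "VSet A" z] t Cons.prems(2) by simp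
qed (simp add: lmul_NR1_left)

text \<open>
  For \<open>g\<close> in \<open>T\<close>, multiplying by \<open>g\<^sup>-\<^sup>1\<close> reduces the claim to \<open>g = r(g)\<close> in \<open>T\<^sup>0\<close>. An element of \<open>T\<^sup>0\<close>
  that overlaps \<open>B\<close> sends a nonzero irreducible word with source \<open>B\<close> either to itself or to the same
  word with one more letter in front, and which of the two depends only on \<open>B\<close>. It never yields \<open>0\<close>.
\<close>

lemma lmul_cancel:
  assumes g: "g \<in> gens \<Gamma>" "\<not> is_inv g" and B: "grng \<Gamma> g \<inter> B \<noteq> {}"
    and y: "lmul \<Gamma> (VSet B) y = y" "normal \<Gamma> y" and y': "lmul \<Gamma> (VSet B) y' = y'" "normal \<Gamma> y'"
    and eq: "lmul \<Gamma> g y = lmul \<Gamma> g y'"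
  shows "y = y'"
proof -
  \<comment> \<open>Replaces \<open>g\<close> by an element of \<open>T\<^sup>0\<close>, at the cost of left multiplication by an inverse.\<close>
  have V: "lmul \<Gamma> (VSet (grng \<Gamma> g)) y = lmul \<Gamma> (VSet (grng \<Gamma> g)) y'"
  proof (cases g)
    case (Rel t)
    then show ?thesis using g eq lmul_NR4[of t y] lmul_NR4[of t y'] y y' by simp
  qed (use g eq in auto)
  have shape: "z = [Zero] \<or> (\<exists>h w. z = h # w \<and> gsrc \<Gamma> h = B)"
    if "lmul \<Gamma> (VSet B) z = z" for z
    using that by (cases z) (auto simp: lmul_VSet split: if_splits simp del: lmul.simps(2))
  show ?thesis
    using shape[OF y(1)] shape[OF y'(1)] V B
    by (elim disjE exE conjE) (auto simp: lmul_VSet split: if_splits simp del: lmul.simps(2))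
qed

text \<open>
  The letters are cancelled one by one from the left. What follows the cancelled letter is fixed
  under left multiplication by the source of the next letter, and this source is the set that the
  cancelled letter overlaps.
\<close>

lemma act_forward_cancel:
  assumes "forward u" "overlapping (u @ [VSet A])" "A \<in> T0 \<Gamma>" "normal \<Gamma> z" "normal \<Gamma> z'"
    and "act \<Gamma> u (lmul \<Gamma> (VSet A) z) = act \<Gamma> u (lmul \<Gamma> (VSet A) z')"
  shows "lmul \<Gamma> (VSet A) z = lmul \<Gamma> (VSet A) z'"
  using assms
proof (induction u)
  case (Cons g u)
  let ?B = "gsrc \<Gamma> (hd (u @ [VSet A]))"
  let ?y = "\<lambda>z. act \<Gamma> u (lmul \<Gamma> (VSet A) z)"
  have u: "forward u" "g \<in> gens \<Gamma>" "\<not> is_inv g" "u \<in> lists (syms \<Gamma>)"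
    using Cons.prems(1) by (auto simp: forward_def)
  have o: "overlapping (u @ [VSet A])" "grng \<Gamma> g \<inter> ?B \<noteq> {}"
    using Cons.prems(2) by (cases u; auto simp: overlapping_def)+
  have stable: "lmul \<Gamma> (VSet ?B) (?y z) = ?y z" for z
    using lmul_NR1_left[of "VSet A" z] Cons.prems(3) lmul_NR1_left[of "hd u"] u
    by (cases u) (auto simp: forward_def)
  have "normal \<Gamma> (?y z)" if "normal \<Gamma> z" for z
    using that u(4) Cons.prems(3) by (intro normal_act normal_lmul) auto
  with lmul_cancel[OF u(2,3) o(2) stable _ stable, of z z'] Cons.prems
  have "?y z = ?y z'" by simp
  with Cons u o show ?case by simp
qed simp

lemma act_path_cancel:
  assumes "path_into A q" "A \<in> T0 \<Gamma>" "normal \<Gamma> z" "normal \<Gamma> z'"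
    and "act \<Gamma> (map Rel (rev q)) (lmul \<Gamma> (VSet A) z) = act \<Gamma> (map Rel (rev q)) (lmul \<Gamma> (VSet A) z')"
  shows "lmul \<Gamma> (VSet A) z = lmul \<Gamma> (VSet A) z'"
  using assms act_inverse_path by metis

lemma normal_split:
  "successively (irreducible_pair \<Gamma>) w \<Longrightarrow> \<exists>u q. w = u @ map Inv q \<and> (\<forall>g\<in>set u. \<not> is_inv g)"
proof (induction w)
  case (Cons g w)
  then obtain u q where w: "w = u @ map Inv q" "\<forall>g\<in>set u. \<not> is_inv g"
    by (auto simp: successively_Cons)
  show ?case
  proof (cases "is_inv g")
    case True
    then obtain t where t: "g = Inv t" by (cases g) auto
    have "u = []" using Cons.prems w t by (cases u) (auto simp: irreducible_pair_def)
    then have "g # w = [] @ map Inv (t # q)" using w t by simp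
    then show ?thesis by (metis empty_iff empty_set)
  next
    case False
    then have "g # w = (g # u) @ map Inv q \<and> (\<forall>h\<in>set (g # u). \<not> is_inv h)" using w by simp
    then show ?thesis by blast
  qed
qed simp

lemma path_into_if_irreducible:
  assumes "successively (irreducible_pair \<Gamma>) (map Inv q)" "set q \<subseteq> rels \<Gamma>" "q \<noteq> [] \<Longrightarrow> rng \<Gamma> (hd q) = A"
  shows "path_into A q"
  using assms
proof (induction q arbitrary: A)
  case (Cons t q)
  then show ?case by (cases q) (auto simp: irreducible_pair_def)
qed simp

text \<open>
  In an irreducible word only inverses follow an inverse. Hence it is a word over \<open>T \<union> T\<^sup>0\<close>
  followed by an inverse path. The set \<open>A\<close> between the two parts is absorbed by the inverse
  path, or by the last letter of the first part if the path is empty.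
\<close>

lemma normal_decomp:
  assumes "normal \<Gamma> w" "w \<noteq> []" "w \<noteq> [Zero]"
  obtains u A q where "w = u @ map Inv q" "forward u" "A \<in> T0 \<Gamma>" "path_into A q"
    "overlapping (u @ [VSet A])"
    "\<And>z. act \<Gamma> w z = act \<Gamma> u (lmul \<Gamma> (VSet A) (act \<Gamma> (map Inv q) z))"
proof -
  have w: "w \<in> lists (gens \<Gamma>)" "successively (irreducible_pair \<Gamma>) w" using assms by (auto simp: normal_def)
  obtain u q where uq: "w = u @ map Inv q" "\<forall>g\<in>set u. \<not> is_inv g" using normal_split[OF w(2)] by blast
  define A where "A = (if q = [] then grng \<Gamma> (last u) else rng \<Gamma> (hd q))"
  have q: "set q \<subseteq> rels \<Gamma>" using w(1) uq by auto
  have last: "u \<noteq> [] \<Longrightarrow> last u \<in> gens \<Gamma>" using w(1) uq by auto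
  have A: "A \<in> T0 \<Gamma>"
    using assms(2) uq(1) last q by (cases q) (auto simp: A_def)
  have "forward u" using w(1) uq by (auto simp: forward_def)
  moreover have "path_into A q"
    using w(2) q by (intro path_into_if_irreducible) (auto simp: uq(1) successively_append_iff A_def)
  moreover have "overlapping (u @ [VSet A])"
  proof -
    have "overlapping u"
      using w(2) unfolding overlapping_def uq(1) successively_append_iff
      by (elim conjE successively_mono) (auto simp: irreducible_pair_def)
    moreover have "grng \<Gamma> (last u) \<inter> A \<noteq> {}" if "u \<noteq> []"
      using w(2) that T0_nonempty[OF A] unfolding uq(1) successively_append_iff A_def
      by (cases q) (auto simp: irreducible_pair_def)
    ultimately show ?thesis by (auto simp: overlapping_def successively_append_iff)
  qed
  moreover have "act \<Gamma> w z = act \<Gamma> u (lmul \<Gamma> (VSet A) (act \<Gamma> (map Inv q) z))" for z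
  proof (cases q)
    case Nil
    then have "u = butlast u @ [last u]" "last u \<in> gens \<Gamma>" using assms(2) uq(1) last by auto
    moreover have "act \<Gamma> (butlast u @ [last u]) (lmul \<Gamma> (VSet A) z) = act \<Gamma> (butlast u @ [last u]) z"
      using Nil lmul_NR1_right[OF \<open>last u \<in> gens \<Gamma>\<close>, of z] by (simp add: A_def)
    ultimately show ?thesis using Nil uq(1) by simp
  next
    case (Cons t q')
    then show ?thesis using lmul_NR1_left[of "Inv t"] q uq(1) by (simp add: A_def)
  qed
  ultimately show thesis using that uq(1) A by blast
qed

section \<open>The idempotents of the L*-classes\<close>

text \<open>
  Left multiplication by \<open>t\<^sup>-\<^sup>1\<close> leaves an inverse in every nonzero product, unless it cancels a
  leading \<open>t\<close>; in that case multiplication by \<open>t\<close> restores the word.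
\<close>

lemma lmul_Inv_forward:
  assumes "normal \<Gamma> z" "t \<in> rels \<Gamma>"
    and y: "lmul \<Gamma> (Inv t) z \<noteq> [Zero]" "\<forall>g\<in>set (lmul \<Gamma> (Inv t) z). \<not> is_inv g"
  shows "z = lmul \<Gamma> (Rel t) (lmul \<Gamma> (Inv t) z) \<and> z \<noteq> [Zero] \<and> (\<forall>g\<in>set z. \<not> is_inv g)"
proof -
  obtain w where z: "z = Rel t # w"
    using y by (cases z) (auto split: if_splits gen.splits)
  have Inv: "lmul \<Gamma> (Inv t) z = lmul \<Gamma> (VSet (rng \<Gamma> t)) w"
    using y unfolding z by (auto simp: irreducible_pair_def split: if_splits)
  have "w \<noteq> [Zero]" using Inv y by auto
  then have "normal \<Gamma> (Rel t # w)" "nf \<Gamma> (Rel t # w) = lmul \<Gamma> (Rel t) w" "normal \<Gamma> w"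
    using assms(1) nf_normal[of w] unfolding z by (auto simp: normal_Cons)
  then have "lmul \<Gamma> (Rel t) w = z" using nf_normal[of z] z by simp
  moreover have "lmul \<Gamma> (Rel t) (lmul \<Gamma> (VSet (rng \<Gamma> t)) w) = lmul \<Gamma> (Rel t) w"
    using lmul_NR1_right[of "Rel t" w] assms(2) by simp
  moreover have "\<forall>g\<in>set w. \<not> is_inv g"
    using y unfolding Inv by (cases w) (auto simp: lmul_VSet split: if_splits simp del: lmul.simps(2))
  ultimately show ?thesis using Inv z by simp
qed

lemma act_Inv_forward:
  assumes "normal \<Gamma> y" "set q \<subseteq> rels \<Gamma>"
    and "act \<Gamma> (map Inv q) y \<noteq> [Zero]" "\<forall>g\<in>set (act \<Gamma> (map Inv q) y). \<not> is_inv g"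
  shows "y = act \<Gamma> (map Rel (rev q)) (act \<Gamma> (map Inv q) y)"
  using assms
proof (induction q)
  case (Cons t q)
  let ?z = "act \<Gamma> (map Inv q) y"
  have "normal \<Gamma> ?z" using Cons.prems by (intro normal_act) (auto simp: subset_iff)
  from lmul_Inv_forward[OF this, of t] Cons show ?case by simp
qed simp

lemma idem_word_act:
  "act \<Gamma> (idem_word A q) z = act \<Gamma> (map Rel (rev q)) (lmul \<Gamma> (VSet A) (act \<Gamma> (map Inv q) z))"
  by (simp add: idem_word_def)

lemma idem_word_idem:
  assumes "path_into A q" "A \<in> T0 \<Gamma>" "normal \<Gamma> z"
  shows "act \<Gamma> (idem_word A q) (act \<Gamma> (idem_word A q) z) = act \<Gamma> (idem_word A q) z"
proof -
  have "normal \<Gamma> (act \<Gamma> (map Inv q) z)" by (intro normal_act path_into_lists(2)[OF assms(1)] assms(3))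
  then show ?thesis
    using act_inverse_path[OF assms(1,2)] lmul_NR1_left[of "VSet A"] assms(2)
    by (simp add: idem_word_act)
qed

text \<open>
  Cancelling \<open>q\<close> from \<open>e f = e\<close>, where \<open>e = q A q\<^sup>-\<^sup>1\<close>, gives \<open>A q\<^sup>-\<^sup>1 f = A q\<^sup>-\<^sup>1\<close>. Multiplication by \<open>q A\<close>
  on the right gives \<open>A q\<^sup>-\<^sup>1 f q A = A\<close>. This has no inverse in its normal form, so \<open>q\<^sup>-\<^sup>1\<close> must have
  cancelled completely and \<open>f q A = q A\<close>. Therefore \<open>f e = e\<close>.
\<close>

lemma idem_word_absorbs:
  assumes q: "path_into A q" "A \<in> T0 \<Gamma>" and f: "f \<in> nwords (syms \<Gamma>)"
    and ef: "\<And>z. normal \<Gamma> z \<Longrightarrow> act \<Gamma> (idem_word A q) (act \<Gamma> f z) = act \<Gamma> (idem_word A q) z"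
    and z: "normal \<Gamma> z"
  shows "act \<Gamma> f (act \<Gamma> (idem_word A q) z) = act \<Gamma> (idem_word A q) z"
proof -
  let ?r = "map Rel (rev q) @ [VSet A]"
  have r: "?r \<in> lists (syms \<Gamma>)" using path_into_lists[OF q(1)] q(2) by auto
  have fl: "f \<in> lists (syms \<Gamma>)" using f by (auto simp: nwords_def)
  \<comment> \<open>The element \<open>f q A\<close>, which turns out to be \<open>q A\<close>.\<close>
  define y where "y = nf \<Gamma> (f @ ?r)"
  have nr: "normal \<Gamma> (nf \<Gamma> ?r)" using r by (intro normal_act) auto
  have ny: "normal \<Gamma> y" unfolding y_def using r fl by (intro normal_act) auto
  have "y \<noteq> []" by (simp add: y_def act_nonempty)
  then have ne: "act \<Gamma> (map Inv q) y \<noteq> []" by (rule act_nonempty)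
  have N: "normal \<Gamma> (act \<Gamma> (map Inv q) x)" if "normal \<Gamma> x" for x
    using that path_into_lists(2)[OF q(1)] by (intro normal_act)
  have "act \<Gamma> (idem_word A q) y = act \<Gamma> (idem_word A q) (nf \<Gamma> ?r)"
    using ef[OF nr] by (simp add: y_def)
  then have "lmul \<Gamma> (VSet A) (act \<Gamma> (map Inv q) y) = lmul \<Gamma> (VSet A) (act \<Gamma> (map Inv q) (nf \<Gamma> ?r))"
    unfolding idem_word_act by (intro act_path_cancel[OF q] N nr ny)
  also have "\<dots> = [VSet A]"
    using act_inverse_path[OF q, of "[]"] T0_nonempty[OF q(2)] by simp
  finally have inverse: "act \<Gamma> (map Inv q) y = [VSet A]"
    using ne by (cases "act \<Gamma> (map Inv q) y") (auto simp: lmul_VSet split: if_splits simp del: lmul.simps(2))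
  have "y = act \<Gamma> (map Rel (rev q)) (act \<Gamma> (map Inv q) y)"
    by (rule act_Inv_forward[OF ny path_into_rels[OF q(1)]]) (simp_all add: inverse)
  then have "y = nf \<Gamma> ?r" unfolding inverse by simp
  then have eq: "nf \<Gamma> (f @ ?r) = nf \<Gamma> ?r" unfolding y_def .
  have ne: "f @ ?r \<noteq> []" "?r \<noteq> []" and fr: "f @ ?r \<in> lists (syms \<Gamma>)" using fl r by auto
  have "act \<Gamma> (f @ ?r) x = act \<Gamma> ?r x" if "normal \<Gamma> x" for x
    by (rule act_eq_if_nf_eq[OF fr r ne eq that])
  from this[OF N[OF z]] show ?thesis by (simp add: idem_word_def)
qed

section \<open>The network semigroup as a quotient of words\<close>

definition cls :: "('v, 't) gen list \<Rightarrow> ('v, 't) gen list set" where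
  "cls w = pres_cong (syms \<Gamma>) (network_rels \<Gamma>) `` {w}"

lemma carrier_network: "carrier (network_sgrp \<Gamma>) = cls ` nwords (syms \<Gamma>)"
  by (auto simp: network_sgrp_def presented_sgrp_def quotient_def cls_def)

lemma prod_cls:
  "u \<in> nwords (syms \<Gamma>) \<Longrightarrow> w \<in> nwords (syms \<Gamma>) \<Longrightarrow> cls u \<odot>\<^bsub>network_sgrp \<Gamma>\<^esub> cls w = cls (u @ w)"
  unfolding network_sgrp_def cls_def by (rule presented_sgrp_prod_class)

lemma cls_eq_iff:
  assumes "u \<in> nwords (syms \<Gamma>)" "w \<in> nwords (syms \<Gamma>)"
  shows "cls u = cls w \<longleftrightarrow> nf \<Gamma> u = nf \<Gamma> w"
  using eq_equiv_class_iff[OF equiv_pres_cong assms] eqv_iff_nf[OF assms] by (simp add: cls_def)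

lemma act_eq_if_cls_eq:
  assumes "cls u = cls w" "u \<in> nwords (syms \<Gamma>)" "w \<in> nwords (syms \<Gamma>)" "normal \<Gamma> z"
  shows "act \<Gamma> u z = act \<Gamma> w z"
  using assms cls_eq_iff eqv_iff_nf pres_cong_act by blast

lemma nwords_append_lists:
  "a \<in> nwords (syms \<Gamma>) \<Longrightarrow> y \<in> lists (syms \<Gamma>) \<Longrightarrow> a @ y \<in> nwords (syms \<Gamma>)"
  by (auto simp: nwords_def)

text \<open>
  Right multiplication by an element of \<open>S\<^sup>1\<close> appends a word, the empty one for the adjoined identity.
  So the two kinds of elements need no separate treatment.
\<close>

lemma with_one_cls:
  assumes "x \<in> with_one (network_sgrp \<Gamma>)"
  shows "\<exists>y\<in>lists (syms \<Gamma>). \<forall>a\<in>nwords (syms \<Gamma>). prod1 (network_sgrp \<Gamma>) (cls a) x = cls (a @ y)"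
proof (cases x)
  case None
  then show ?thesis by (intro bexI[of _ "[]"]) auto
next
  case (Some c)
  then obtain y where "y \<in> nwords (syms \<Gamma>)" "c = cls y"
    using assms carrier_network by (auto simp: with_one_def split: if_splits)
  then show ?thesis using Some prod_cls by (intro bexI[of _ y]) (auto simp: nwords_def)
qed

lemma lstar_clsI:
  assumes a: "a \<in> nwords (syms \<Gamma>)" and b: "b \<in> nwords (syms \<Gamma>)"
    and eq: "\<And>z z'. normal \<Gamma> z \<Longrightarrow> normal \<Gamma> z' \<Longrightarrow> act \<Gamma> a z = act \<Gamma> a z' \<longleftrightarrow> act \<Gamma> b z = act \<Gamma> b z'"
  shows "lstar (network_sgrp \<Gamma>) (cls a) (cls b)"
  unfolding lstar_def
proof (intro ballI)
  fix x x' assume "x \<in> with_one (network_sgrp \<Gamma>)" "x' \<in> with_one (network_sgrp \<Gamma>)"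
  then obtain y y' where y: "y \<in> lists (syms \<Gamma>)" "y' \<in> lists (syms \<Gamma>)"
    and prod: "\<And>c. c \<in> nwords (syms \<Gamma>) \<Longrightarrow> prod1 (network_sgrp \<Gamma>) (cls c) x = cls (c @ y)"
      "\<And>c. c \<in> nwords (syms \<Gamma>) \<Longrightarrow> prod1 (network_sgrp \<Gamma>) (cls c) x' = cls (c @ y')"
    using with_one_cls by meson
  have "cls (c @ y) = cls (c @ y') \<longleftrightarrow> act \<Gamma> c (nf \<Gamma> y) = act \<Gamma> c (nf \<Gamma> y')"
    if "c \<in> nwords (syms \<Gamma>)" for c
    using cls_eq_iff[OF nwords_append_lists[OF that y(1)] nwords_append_lists[OF that y(2)]] by simp
  moreover have "normal \<Gamma> (nf \<Gamma> y)" "normal \<Gamma> (nf \<Gamma> y')" using y by (simp_all add: normal_act)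
  ultimately show "prod1 (network_sgrp \<Gamma>) (cls a) x = prod1 (network_sgrp \<Gamma>) (cls a) x' \<longleftrightarrow>
      prod1 (network_sgrp \<Gamma>) (cls b) x = prod1 (network_sgrp \<Gamma>) (cls b) x'"
    using prod a b eq by simp
qed

lemma cls_idempotent:
  assumes "e \<in> nwords (syms \<Gamma>)" "nf \<Gamma> (e @ e) = nf \<Gamma> e"
  shows "cls e \<in> idempotents (network_sgrp \<Gamma>)"
  using assms cls_eq_iff[of "e @ e" e] nwords_append[OF assms(1,1)]
  by (auto simp: idempotents_def carrier_network prod_cls)

lemma idem_word_nwords:
  "path_into A q \<Longrightarrow> A \<in> T0 \<Gamma> \<Longrightarrow> idem_word A q \<in> nwords (syms \<Gamma>)"
  using idem_word_lists by (auto simp: nwords_def idem_word_def)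

lemma act_Zero: "u \<in> lists (syms \<Gamma>) \<Longrightarrow> act \<Gamma> u [Zero] = [Zero]"
  by (induction u) auto

lemma Zero_nwords: "[Zero] \<in> nwords (syms \<Gamma>)"
  by (simp add: nwords_def)

lemma star_cls_Zero: "star (network_sgrp \<Gamma>) (cls [Zero]) = cls [Zero]"
proof (rule star_eqI)
  show "cls [Zero] \<in> idempotents (network_sgrp \<Gamma>)" by (intro cls_idempotent Zero_nwords) simp
  show "lstar (network_sgrp \<Gamma>) (cls [Zero]) (cls [Zero])" by (simp add: lstar_def)
  fix f assume "f \<in> idempotents (network_sgrp \<Gamma>)"
  then obtain w where w: "f = cls w" "w \<in> nwords (syms \<Gamma>)"
    by (auto simp: idempotents_def carrier_network)
  have "nf \<Gamma> (w @ [Zero]) = nf \<Gamma> [Zero]" using w act_Zero[of w] by (simp add: nwords_def)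
  then show "f \<odot>\<^bsub>network_sgrp \<Gamma>\<^esub> cls [Zero] = cls [Zero]"
    using w prod_cls[OF w(2) Zero_nwords] cls_eq_iff[OF nwords_append[OF w(2) Zero_nwords] Zero_nwords]
    by simp
qed

text \<open>
  After cancellation of \<open>u\<close> and of \<open>q\<close> respectively, \<open>w = u A q\<^sup>-\<^sup>1\<close> and \<open>q A q\<^sup>-\<^sup>1\<close> are both compared
  with \<open>A q\<^sup>-\<^sup>1\<close>.
\<close>

lemma star_cls:
  assumes w: "w \<in> nwords (syms \<Gamma>)" and A: "A \<in> T0 \<Gamma>" and q: "path_into A q"
    and u: "forward u" "overlapping (u @ [VSet A])"
    and eq: "\<And>z. normal \<Gamma> z \<Longrightarrow> act \<Gamma> w z = act \<Gamma> u (lmul \<Gamma> (VSet A) (act \<Gamma> (map Inv q) z))"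
  shows "star (network_sgrp \<Gamma>) (cls w) = cls (idem_word A q)"
proof (rule star_eqI)
  let ?e = "idem_word A q"
  have e: "?e \<in> nwords (syms \<Gamma>)" by (rule idem_word_nwords[OF q A])
  show "cls ?e \<in> idempotents (network_sgrp \<Gamma>)"
    using idem_word_idem[OF q A normal_Nil] by (intro cls_idempotent e) simp
  show "lstar (network_sgrp \<Gamma>) (cls w) (cls ?e)"
  proof (rule lstar_clsI[OF w e])
    fix z z' assume z: "normal \<Gamma> z" "normal \<Gamma> z'"
    have n: "normal \<Gamma> (act \<Gamma> (map Inv q) z)" "normal \<Gamma> (act \<Gamma> (map Inv q) z')"
      using z normal_act[OF path_into_lists(2)[OF q]] by simp_all
    show "act \<Gamma> w z = act \<Gamma> w z' \<longleftrightarrow> act \<Gamma> ?e z = act \<Gamma> ?e z'"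
      using act_forward_cancel[OF u A n] act_path_cancel[OF q A n] eq z
      unfolding idem_word_act by metis
  qed
  fix f assume "f \<in> idempotents (network_sgrp \<Gamma>)" "cls ?e \<odot>\<^bsub>network_sgrp \<Gamma>\<^esub> f = cls ?e"
  then obtain v where v: "f = cls v" "v \<in> nwords (syms \<Gamma>)" "cls (?e @ v) = cls ?e"
    using prod_cls[OF e] by (auto simp: idempotents_def carrier_network)
  have "act \<Gamma> ?e (act \<Gamma> v z) = act \<Gamma> ?e z" if "normal \<Gamma> z" for z
    using act_eq_if_cls_eq[OF v(3) nwords_append[OF e v(2)] e that] by simp
  from idem_word_absorbs[OF q A v(2) this normal_Nil]
  have "nf \<Gamma> (v @ ?e) = nf \<Gamma> ?e" by simp
  then show "f \<odot>\<^bsub>network_sgrp \<Gamma>\<^esub> cls ?e = cls ?e"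
    using v prod_cls[OF v(2) e] cls_eq_iff[OF nwords_append[OF v(2) e] e] by simp
qed

section \<open>The ideal generated by a sink\<close>

text \<open>
  On normal forms this describes membership in the ideal generated by \<open>v\<close>, provided that \<open>v\<close> is a sink
  in the sense below. Zero has to be listed, since its source and range are empty.
\<close>

definition touches :: "'v \<Rightarrow> ('v, 't) gen list \<Rightarrow> bool" where
  "touches v z \<longleftrightarrow> z = [Zero] \<or> (\<exists>g\<in>set z. v \<in> gsrc \<Gamma> g \<union> grng \<Gamma> g)"

text \<open>
  More than a vertex without outgoing relations: it must also be isolated from the other elements of
  \<open>T\<^sup>0\<close>, so that it overlaps none of them.
\<close>

definition sink :: "'v \<Rightarrow> bool" where
  "sink v \<longleftrightarrow> (\<forall>A\<in>T0 \<Gamma>. v \<in> A \<longrightarrow> A = {v}) \<and> (\<forall>t\<in>rels \<Gamma>. src \<Gamma> t \<noteq> {v})"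

lemma sink_notin_src: "sink v \<Longrightarrow> t \<in> rels \<Gamma> \<Longrightarrow> v \<notin> src \<Gamma> t"
  using src_rng_in(1) by (auto simp: sink_def)

lemma sink_T0: "sink v \<Longrightarrow> A \<in> T0 \<Gamma> \<Longrightarrow> v \<in> A \<Longrightarrow> A = {v}"
  by (auto simp: sink_def)

lemma touches_lmul_VSet:
  assumes "A \<in> T0 \<Gamma>" "v \<in> A \<or> touches v z"
  shows "touches v (lmul \<Gamma> (VSet A) z)"
  using assms by (cases z) (auto simp: touches_def lmul_VSet simp del: lmul.simps(2))

text \<open>
  A letter of \<open>T\<^sup>0\<close> is deleted only next to a letter that has it as source or range, and that letter
  remains. The cancellation \<open>t\<^sup>-\<^sup>1 t = r(t)\<close> keeps the range of \<open>t\<close> and loses its source, which does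
  not contain a sink.
\<close>

lemma touches_lmul:
  assumes v: "sink v" and g: "g \<in> syms \<Gamma>" and z: "normal \<Gamma> z"
    and m: "v \<in> gsrc \<Gamma> g \<union> grng \<Gamma> g \<or> touches v z"
  shows "touches v (lmul \<Gamma> g z)"
proof (cases z)
  case Nil
  then show ?thesis using m by (auto simp: touches_def)
next
  case (Cons h w)
  have "h \<in> syms \<Gamma>" using z Cons by (auto simp: normal_Cons)
  have V: "touches v (lmul \<Gamma> (VSet (rng \<Gamma> t)) w)"
    if "t \<in> rels \<Gamma>" "v \<in> rng \<Gamma> t \<or> touches v w" for t
    using that by (intro touches_lmul_VSet) auto
  show ?thesis using m g v sink_notin_src[OF v] V \<open>h \<in> syms \<Gamma>\<close> Cons
    by (cases g; cases h) (auto simp: touches_def split: if_splits)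
qed

lemma touches_act:
  assumes v: "sink v" and u: "u \<in> lists (syms \<Gamma>)" and z: "normal \<Gamma> z" and m: "touches v u \<or> touches v z"
  shows "touches v (act \<Gamma> u z)"
proof (cases "u = [Zero]")
  case True
  then show ?thesis by (simp add: touches_def)
next
  case False
  then have "(\<exists>g\<in>set u. v \<in> gsrc \<Gamma> g \<union> grng \<Gamma> g) \<or> touches v z" using m by (auto simp: touches_def)
  then show ?thesis using u
  proof (induction u)
    case (Cons g u)
    have "normal \<Gamma> (act \<Gamma> u z)" using Cons.prems z by (intro normal_act) simp_all
    then show ?case using Cons by (auto intro!: touches_lmul[OF v])
  qed simp
qed

text \<open>
  A letter of \<open>T \<union> T\<^sup>0\<close> that touches \<open>v\<close> has range \<open>v\<close>, since no source contains \<open>v\<close>. The next letter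
  has to overlap it, so its source is \<open>v\<close> and it is the vertex \<open>v\<close> itself.
\<close>

lemma sink_reaches_end:
  assumes v: "sink v" and "forward u" "overlapping (u @ [VSet A])" "A \<in> T0 \<Gamma>"
    and "g \<in> set u" "v \<in> gsrc \<Gamma> g \<union> grng \<Gamma> g"
  shows "v \<in> A"
  using assms(2-)
proof (induction u arbitrary: g)
  case (Cons k u)
  let ?h = "hd (u @ [VSet A])"
  have k: "k \<in> gens \<Gamma>" "\<not> is_inv k" and u: "forward u" "overlapping (u @ [VSet A])"
    and h: "grng \<Gamma> k \<inter> gsrc \<Gamma> ?h \<noteq> {}"
    using Cons.prems(1,2) by (cases u; auto simp: forward_def overlapping_def)+
  show ?case
  proof (cases "g = k")
    case True
    then have "v \<in> grng \<Gamma> k"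
      using Cons.prems(5) k sink_notin_src[OF v] by (cases k) auto
    then have "grng \<Gamma> k = {v}" using k(1) by (intro sink_T0[OF v]) auto
    then have "v \<in> gsrc \<Gamma> ?h" using h by auto
    then show ?thesis using Cons.IH[OF u Cons.prems(3)] by (cases u) auto
  next
    case False
    then show ?thesis using Cons.IH[OF u Cons.prems(3)] Cons.prems by auto
  qed
qed simp

text \<open>
  Every element has its idempotent inside the semigroup, and the idempotent of an element
  of the ideal lies in the ideal.
\<close>

lemma star_cls_touches:
  assumes w: "w \<in> nwords (syms \<Gamma>)"
  obtains e where "e \<in> nwords (syms \<Gamma>)" "star (network_sgrp \<Gamma>) (cls w) = cls e"
    "\<And>v. sink v \<Longrightarrow> touches v (nf \<Gamma> w) \<Longrightarrow> touches v (nf \<Gamma> e)"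
proof -
  have wl: "w \<in> lists (syms \<Gamma>)" "w \<noteq> []" using w by (auto simp: nwords_def)
  let ?n = "nf \<Gamma> w"
  have n: "normal \<Gamma> ?n" using wl by (intro normal_act) auto
  have ne: "?n \<noteq> []" using wl by (cases w) (auto simp: lmul_nonempty)
  have nn: "?n \<in> nwords (syms \<Gamma>)" using ne normal_lists[OF n] by (auto simp: nwords_def)
  have wn: "cls w = cls ?n" using cls_eq_iff[OF w nn] nf_normal[OF n] by simp
  show thesis
  proof (cases "?n = [Zero]")
    case True
    have "star (network_sgrp \<Gamma>) (cls w) = cls [Zero]" unfolding wn True by (rule star_cls_Zero)
    moreover have "touches v (nf \<Gamma> [Zero])" for v by (simp add: touches_def)
    ultimately show ?thesis by (rule that[OF Zero_nwords])
  next
    case False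
    obtain u A q where d: "?n = u @ map Inv q" "forward u" "A \<in> T0 \<Gamma>" "path_into A q"
      "overlapping (u @ [VSet A])"
      "\<And>z. act \<Gamma> ?n z = act \<Gamma> u (lmul \<Gamma> (VSet A) (act \<Gamma> (map Inv q) z))"
      by (rule normal_decomp[OF n ne False], rule that)
    let ?e = "idem_word A q"
    have "touches v (nf \<Gamma> ?e)" if v: "sink v" and m: "touches v ?n" for v
    proof -
      obtain g where g: "g \<in> set ?n" "v \<in> gsrc \<Gamma> g \<union> grng \<Gamma> g"
        using m False by (auto simp: touches_def)
      have "touches v ?e"
      proof (cases "g \<in> set u")
        case True
        then have "v \<in> A" using sink_reaches_end[OF v d(2,5,3)] g by blast
        then show ?thesis by (auto simp: touches_def idem_word_def)
      next
        case False
        then have "g \<in> set ?e" using g(1) unfolding d(1) by (simp add: idem_word_def)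
        then show ?thesis using g(2) by (auto simp: touches_def)
      qed
      then show ?thesis using idem_word_lists[OF d(4,3)] by (intro touches_act[OF v]) auto
    qed
    moreover have "star (network_sgrp \<Gamma>) (cls w) = cls ?e"
      unfolding wn by (rule star_cls[OF nn d(3,4,2,5) d(6)])
    ultimately show ?thesis using that idem_word_nwords[OF d(4,3)] by blast
  qed
qed

lemma not_star_congruence_free_if_sink:
  assumes v: "sink v" "v \<in> verts \<Gamma>" and C: "C \<in> T0 \<Gamma>" "v \<notin> C"
  shows "\<not> star_congruence_free (network_sgrp \<Gamma>)"
proof -
  let ?X = "syms \<Gamma>"
  let ?I = "cls ` {w \<in> nwords ?X. touches v (nf \<Gamma> w)}"
  have mem: "cls w \<in> ?I \<longleftrightarrow> touches v (nf \<Gamma> w)" if "w \<in> nwords ?X" for w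
    using that by (auto simp: cls_eq_iff)
  have nf: "normal \<Gamma> (nf \<Gamma> w)" if "w \<in> nwords ?X" for w
    using that by (intro normal_act) (auto simp: nwords_def)
  have ideal: "touches v (nf \<Gamma> (a @ b))"
    if ab: "a \<in> nwords ?X" "b \<in> nwords ?X" and m: "touches v (nf \<Gamma> a) \<or> touches v (nf \<Gamma> b)" for a b
  proof -
    have al: "a \<in> lists ?X" "a \<noteq> []" using ab by (auto simp: nwords_def)
    have "act \<Gamma> (nf \<Gamma> a) (nf \<Gamma> b) = act \<Gamma> a (nf \<Gamma> b)"
      using pres_cong_act[OF eqv_nf[OF al] nf[OF ab(2)]] by simp
    moreover have "touches v (act \<Gamma> (nf \<Gamma> a) (nf \<Gamma> b))"
      by (intro touches_act v normal_lists nf ab m)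
    ultimately show ?thesis by simp
  qed
  have V: "[VSet A] \<in> nwords ?X" if "A \<in> T0 \<Gamma>" for A
    using that by (auto simp: nwords_def)
  have v0: "{v} \<in> T0 \<Gamma>" using v by (auto simp: T0_def vsingletons_def)
  show ?thesis
  proof (rule not_star_congruence_free_if_ideal)
    show "sgroup (network_sgrp \<Gamma>)"
      unfolding network_sgrp_def by (rule sgroup_presented_sgrp)
    show "?I \<subseteq> carrier (network_sgrp \<Gamma>)" by (auto simp: carrier_network)
    show "a \<odot>\<^bsub>network_sgrp \<Gamma>\<^esub> b \<in> ?I \<and> b \<odot>\<^bsub>network_sgrp \<Gamma>\<^esub> a \<in> ?I"
      if ab: "a \<in> ?I" "b \<in> carrier (network_sgrp \<Gamma>)" for a b
    proof -
      obtain x y where "a = cls x" "b = cls y" "x \<in> nwords ?X" "y \<in> nwords ?X" "touches v (nf \<Gamma> x)"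
        using ab by (auto simp: carrier_network)
      then show ?thesis
        using ideal[of x y] ideal[of y x] mem[of "x @ y"] mem[of "y @ x"]
        by (simp add: prod_cls nwords_append)
    qed
    show "star (network_sgrp \<Gamma>) a \<in> carrier (network_sgrp \<Gamma>)"
      if a: "a \<in> carrier (network_sgrp \<Gamma>)" for a
    proof -
      obtain w where w: "a = cls w" "w \<in> nwords ?X" using a by (auto simp: carrier_network)
      obtain e where "e \<in> nwords ?X" "star (network_sgrp \<Gamma>) a = cls e"
        unfolding w(1) by (rule star_cls_touches[OF w(2)])
      then show ?thesis by (simp add: carrier_network)
    qed
    show "star (network_sgrp \<Gamma>) a \<in> ?I" if a: "a \<in> ?I" for a
    proof -
      obtain w where w: "a = cls w" "w \<in> nwords ?X" "touches v (nf \<Gamma> w)" using a by auto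
      obtain e where e: "e \<in> nwords ?X" "star (network_sgrp \<Gamma>) (cls w) = cls e"
        "\<And>x. sink x \<Longrightarrow> touches x (nf \<Gamma> w) \<Longrightarrow> touches x (nf \<Gamma> e)"
        by (rule star_cls_touches[OF w(2)], rule that)
      from e(3)[OF v(1) w(3)] e(1,2) show ?thesis using mem w(1) by simp
    qed
    show "cls [Zero] \<in> ?I" "cls [VSet {v}] \<in> ?I"
      using mem[OF Zero_nwords] mem[OF V[OF v0]] by (simp_all add: touches_def)
    show "cls [Zero] \<noteq> cls [VSet {v}]"
      using cls_eq_iff[OF Zero_nwords V[OF v0]] by simp
    show "cls [VSet C] \<in> carrier (network_sgrp \<Gamma>)" using V[OF C(1)] by (simp add: carrier_network)
    show "cls [VSet C] \<notin> ?I" using mem[OF V[OF C(1)]] C(2) by (simp add: touches_def)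
  qed
qed

end

theorem theorem4p5:
  fixes \<Gamma> :: "('v, 't) net"
  assumes "network \<Gamma>"
    and "\<exists>t\<in>rels \<Gamma>. outdeg \<Gamma> (rng \<Gamma> t) = 0 \<and>
           \<not> (\<exists>A \<in> T0 \<Gamma> - vsingletons \<Gamma>. rng \<Gamma> t \<subseteq> A)"
  shows "\<not> star_congruence_free (network_sgrp \<Gamma>)"
proof -
  interpret network \<Gamma> by fact
  obtain t where t: "t \<in> rels \<Gamma>" "outdeg \<Gamma> (rng \<Gamma> t) = 0"
    and sup: "\<And>A. A \<in> T0 \<Gamma> \<Longrightarrow> rng \<Gamma> t \<subseteq> A \<Longrightarrow> A \<in> vsingletons \<Gamma>"
    using assms(2) by blast
  obtain v where v: "rng \<Gamma> t = {v}" "v \<in> verts \<Gamma>"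
    using sup[of "rng \<Gamma> t"] src_rng_in(2)[OF t(1)] by (auto simp: vsingletons_def)
  have "{s \<in> rels \<Gamma>. src \<Gamma> s = {v}} = {}"
    using t(2) unfolding v(1) by (auto simp: outdeg_def zero_enat_def split: if_splits)
  moreover have "A = {v}" if "A \<in> T0 \<Gamma>" "v \<in> A" for A
    using sup[of A] that v(1) by (auto simp: vsingletons_def)
  ultimately have "sink v" by (auto simp: sink_def)
  moreover have "v \<notin> src \<Gamma> t" using src_rng_disjoint[OF t(1)] v(1) by auto
  ultimately show ?thesis
    using not_star_congruence_free_if_sink v(2) src_rng_in(1)[OF t(1)] by blast
qed

end
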